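(* There exist a constant $c>0$ and a function $g:\mathbb{N}\to\mathbb{R}_{\ge 0}$ with $g(n)/n\to 0$ as $n\to\infty$ such that for every positive integer $n$ there is a set of at most $2^{g(n)}$ permutations of $[n]=\{1,\dots,n\}$ such that any sequence containing all these permutations as subsequences has length at least $c\,n^2$.
   Context: Permutations of $[n]$ are regarded as ordered arrangements, i.e. words $i_1i_2\dots i_n$ in which each element of $[n]$ appears exactly once. A subsequence of a sequence $s$ is any sequence obtained by deleting some (possibly no) elements of $s$; its letters need not be contiguous in $s$. *)

theory Defs
  imports Complex_Main "HOL-Library.Sublist" "HOL-Combinatorics.Multiset_Permutations"
begin

end

(* Counting. A word s of length L contains at most (L choose n) <= L^n / n! permutations of [n]
   as subsequences. For L <= n^2 / e^3 and n! >= (n/e)^n this is at most e^(-n) n!, so a tuple of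
   N = n^2 independent uniform permutations lies inside s with probability at most e^(-n^3).
   There are only n^L < e^(n^3) candidate words s, so by the union bound some n^2 permutations
   have no common supersequence of length L. *)

theory Submission
  imports Defs "HOL-Real_Asymp.Real_Asymp"
begin

text \<open>Every subsequence of length \<open>n\<close> is read off from some
  \<open>n\<close>-element set of positions of \<open>s\<close>; different sets may give the same
  word, hence only an upper bound.\<close>

lemma card_subseqs_length_le:
  shows "finite {p. subseq p s \<and> length p = n}" (is "finite ?A")
    and "card {p. subseq p s \<and> length p = n} \<le> length s choose n"
proof -
  let ?B = "{I. I \<subseteq> {..<length s} \<and> card I = n}"
  have sub: "?A \<subseteq> nths s ` ?B"
  proof
    fix p assume "p \<in> ?A"
    then obtain I where I: "p = nths s I" "length p = n"
      by (auto simp: subseq_conv_nths)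
    \<comment> \<open>\<open>I\<close> may contain indices past the end of \<open>s\<close>, which
      \<open>nths\<close> ignores; once trimmed, its cardinality is the length of
      \<open>p\<close>.\<close>
    let ?J = "{i. i < length s \<and> i \<in> I}"
    have "p = nths s ?J"
      unfolding I(1) nths_def
      by (intro arg_cong[where f = "map fst"] filter_cong) (auto simp: set_zip)
    moreover have "?J \<in> ?B"
      using I by (auto simp: length_nths)
    ultimately show "p \<in> nths s ` ?B" by blast
  qed
  have fin: "finite ?B" by simp
  show "finite ?A" using sub fin finite_surj by blast
  have "card ?A \<le> card ?B" using sub fin surj_card_le by blast
  then show "card ?A \<le> length s choose n" by (simp add: n_subsets)
qed

text \<open>Deleting the letters outside \<open>A\<close> and padding with \<open>a\<close> loses no
  subsequence over \<open>A\<close>. So the union bound has to range only over words on [n] of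
  length exactly \<open>L\<close>, of which there are \<open>n ^ L\<close>.\<close>

lemma subseq_extend_in_alphabet:
  assumes "a \<in> A" "length s \<le> L"
  obtains t where "set t \<subseteq> A" "length t = L"
    "\<And>p. set p \<subseteq> A \<Longrightarrow> subseq p s \<Longrightarrow> subseq p t"
proof
  let ?f = "filter (\<lambda>x. x \<in> A) s"
  let ?t = "?f @ replicate (L - length ?f) a"
  show "set ?t \<subseteq> A" using assms by auto
  have "length ?f \<le> L" using assms(2) length_filter_le order_trans by blast
  then show "length ?t = L" by simp
  fix p assume p: "set p \<subseteq> A" "subseq p s"
  have "subseq (filter (\<lambda>x. x \<in> A) p) ?f" using p(2) by (rule subseq_filter)
  moreover have "filter (\<lambda>x. x \<in> A) p = p" using p(1) by (auto simp: filter_id_conv)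
  ultimately show "subseq p ?t" by (simp add: list_emb_prefix)
qed

text \<open>The union bound as a count: each of the \<open>n ^ L\<close> words covers at most
  \<open>(L choose n) ^ N\<close> of the \<open>fact n ^ N\<close> tuples of permutations, so some
  tuple is covered by none. Tuples are lists with repetition allowed, which makes the counts pure
  powers and gives \<open>card P \<le> N\<close>.\<close>

lemma exists_tuple_without_short_superseq:
  assumes count: "n ^ L * (L choose n) ^ N < fact n ^ N" and n: "n \<ge> 1"
  obtains P :: "nat list set" where "P \<subseteq> permutations_of_set {1..n}" "card P \<le> N"
    "\<And>s. (\<forall>p\<in>P. subseq p s) \<Longrightarrow> length s > L"
proof -
  let ?S = "permutations_of_set {1..n}"
  let ?T = "{ps. set ps \<subseteq> ?S \<and> length ps = N}"
  let ?W = "{s. set s \<subseteq> {1..n} \<and> length s = L}"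
  let ?C = "\<lambda>s. {p. subseq p s \<and> length p = n}"
  let ?B = "\<lambda>s. {ps. set ps \<subseteq> ?C s \<and> length ps = N}"
  have finW: "finite ?W" by (simp add: finite_lists_length_eq)
  have finU: "finite (\<Union>s\<in>?W. ?B s)"
    by (intro finite_UN_I[OF finW] finite_lists_length_eq card_subseqs_length_le(1))
  have "card (\<Union>s\<in>?W. ?B s) \<le> (\<Sum>s\<in>?W. card (?B s))"
    using finW by (rule card_UN_le)
  also have "\<dots> \<le> (\<Sum>s\<in>?W. (L choose n) ^ N)"
  proof (rule sum_mono)
    fix s assume "s \<in> ?W"
    then show "card (?B s) \<le> (L choose n) ^ N"
      using card_subseqs_length_le[of s n] by (auto simp: card_lists_length_eq intro: power_mono)
  qed
  also have "\<dots> = n ^ L * (L choose n) ^ N"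
    by (simp add: card_lists_length_eq)
  also have "\<dots> < card ?T"
    using count by (simp add: card_lists_length_eq)
  finally have "\<not> ?T \<subseteq> (\<Union>s\<in>?W. ?B s)"
    using card_mono[OF finU] by (meson not_le)
  then obtain ps where ps: "set ps \<subseteq> ?S" "length ps = N" "\<And>s. s \<in> ?W \<Longrightarrow> ps \<notin> ?B s"
    by blast
  show ?thesis
  proof
    show "set ps \<subseteq> ?S" by fact
    show "card (set ps) \<le> N" using ps(2) card_length by blast
    fix s assume s: "\<forall>p\<in>set ps. subseq p s"
    show "length s > L"
    proof (rule ccontr)
      assume "\<not> length s > L"
      then obtain t where t: "set t \<subseteq> {1..n}" "length t = L"
        "\<And>p. set p \<subseteq> {1..n} \<Longrightarrow> subseq p s \<Longrightarrow> subseq p t"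
        using n subseq_extend_in_alphabet[of 1 "{1..n}" s L] by auto
      have "p \<in> ?C t" if "p \<in> set ps" for p
      proof -
        have "p \<in> ?S" using that ps(1) by blast
        then have "set p = {1..n}" "length p = n"
          by (auto simp: permutations_of_set_def distinct_card[symmetric])
        then show ?thesis using t(3) s that by auto
      qed
      then have "ps \<in> ?B t" using ps(2) by blast
      then show False using ps(3) t by blast
    qed
  qed
qed

text \<open>The term \<open>k = n\<close> of the exponential series at \<open>n\<close> is at most
  the whole sum.\<close>

lemma pow_self_le_fact_mult_exp: "real n ^ n \<le> fact n * exp (real n)"
proof -
  have "(\<Sum>k\<in>{n}. inverse (fact k) * real n ^ k) \<le> exp (real n)"
    unfolding exp_def real_scaleR_def
    using summable_exp[of "real n"] by (intro sum_le_suminf) auto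
  then show ?thesis by (simp add: field_simps)
qed

lemma superseq_count_bound:
  assumes L: "real L \<le> exp (-3) * (real n)\<^sup>2" and n: "n \<ge> 1"
  shows "n ^ L * (L choose n) ^ n\<^sup>2 < fact n ^ n\<^sup>2"
proof -
  \<comment> \<open>Here \<open>e\<close> is the \<open>n\<close>-th power of Euler's
    number.\<close>
  define e where "e = exp (real n)"
  define f :: real where "f = fact n"
  define b where "b = real (L choose n)"
  have e: "e > 0" and f: "f > 0" and b: "b \<ge> 0" by (simp_all add: e_def f_def b_def)
  have "b * f \<le> real L ^ n"
    using binomial_fact_pow[of L n] unfolding b_def f_def
    by (metis of_nat_fact of_nat_le_iff of_nat_mult of_nat_power)
  also have "\<dots> \<le> (exp (-3) * (real n)\<^sup>2) ^ n"
    using L by (intro power_mono) auto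
  also have "\<dots> = (real n ^ n)\<^sup>2 / e ^ 3"
    by (simp add: e_def power_mult_distrib exp_minus field_simps flip: exp_of_nat_mult power_mult)
  \<comment> \<open>Of the three factors \<open>1 / e\<close> supplied by the constant
    \<open>exp (-3)\<close>, two pay for replacing both copies of \<open>n ^ n\<close> by
    \<open>f\<close>; the third is the gain that beats the number of words.\<close>
  also have "\<dots> \<le> (f * e)\<^sup>2 / e ^ 3"
    using e pow_self_le_fact_mult_exp[of n]
    by (intro divide_right_mono power_mono) (auto simp: e_def f_def)
  also have "\<dots> = f * (f / e)"
    using e by (simp add: field_simps power2_eq_square power3_eq_cube)
  finally have be: "b * e \<le> f"
    using e f by (simp add: field_simps)
  have "real L \<le> 1 * (real n)\<^sup>2"
    using L by (rule order_trans) (intro mult_right_mono; simp)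
  then have Ln: "L \<le> n\<^sup>2"
    by (metis mult_1 of_nat_le_iff of_nat_power)
  have "real n ^ L \<le> real n ^ n\<^sup>2"
    using Ln n by (intro power_increasing) auto
  also have "\<dots> < e ^ n\<^sup>2"
    unfolding e_def
  proof (rule power_strict_mono)
    show "real n < exp (real n)" using exp_ge_add_one_self[of "real n"] by linarith
  qed (use n in auto)
  finally have ne: "real n ^ L < e ^ n\<^sup>2" .
  have "real n ^ L * b ^ n\<^sup>2 < f ^ n\<^sup>2"
  \<comment> \<open>Strictness survives multiplication by \<open>b ^ n\<^sup>2\<close> only for
    positive \<open>b\<close>; \<open>b = 0\<close> is the case \<open>L < n\<close>.\<close>
  proof (cases "b = 0")
    case True
    then show ?thesis using f n by (simp add: power_0_left)
  next
    case False
    then have "real n ^ L * b ^ n\<^sup>2 < e ^ n\<^sup>2 * b ^ n\<^sup>2"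
      using ne b by simp
    also have "\<dots> = (b * e) ^ n\<^sup>2" by (simp add: power_mult_distrib)
    also have "\<dots> \<le> f ^ n\<^sup>2" using be b e by (intro power_mono) auto
    finally show ?thesis .
  qed
  then have "real (n ^ L * (L choose n) ^ n\<^sup>2) < real (fact n ^ n\<^sup>2)"
    by (simp add: b_def f_def)
  then show ?thesis by (simp only: of_nat_less_iff)
qed

theorem theorem3:
  shows "\<exists>(c::real) (g :: nat \<Rightarrow> real).
           c > 0 \<and> (\<forall>n. g n \<ge> 0) \<and> (\<lambda>n. g n / real n) \<longlonglongrightarrow> 0 \<and>
           (\<forall>n\<ge>1. \<exists>P :: nat list set.
              P \<subseteq> permutations_of_set {1..n} \<and>
              real (card P) \<le> 2 powr g n \<and>
              (\<forall>s :: nat list. (\<forall>p\<in>P. subseq p s) \<longrightarrow> real (length s) \<ge> c * (real n)\<^sup>2))"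
proof (rule exI, rule exI, intro conjI allI impI)
  \<comment> \<open>Chosen so that \<open>2 powr g n\<close> is the tuple length
    \<open>n\<^sup>2\<close>. At \<open>n = 0\<close> the convention \<open>ln 0 = 0\<close> gives
    \<open>g 0 = 0\<close>.\<close>
  define g where "g = (\<lambda>n. 2 * log 2 (real n))"
  show "exp (-3) > (0::real)" by simp
  show "g n \<ge> 0" for n by (cases n) (auto simp: g_def log_def)
  show "(\<lambda>n. g n / real n) \<longlonglongrightarrow> 0" unfolding g_def by real_asymp
  fix n :: nat assume n: "n \<ge> 1"
  \<comment> \<open>Rounding down costs nothing: a length above \<open>L\<close> is at least
    \<open>L + 1\<close>, which exceeds \<open>exp (-3) * (real n)\<^sup>2\<close>.\<close>
  define L where "L = nat \<lfloor>exp (-3) * (real n)\<^sup>2\<rfloor>"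
  have L: "real L \<le> exp (-3) * (real n)\<^sup>2" "exp (-3) * (real n)\<^sup>2 < real L + 1"
    unfolding L_def by simp_all
  obtain P where P: "P \<subseteq> permutations_of_set {1..n}" "card P \<le> n\<^sup>2"
    "\<And>s. (\<forall>p\<in>P. subseq p s) \<Longrightarrow> length s > L"
    using exists_tuple_without_short_superseq[OF superseq_count_bound[OF L(1) n] n] by blast
  have "2 powr g n = (2 powr log 2 (real n)) powr 2"
    by (simp add: g_def powr_powr mult.commute)
  then have "2 powr g n = real (n\<^sup>2)"
    using n by (simp add: powr_numeral)
  then have "real (card P) \<le> 2 powr g n" using P(2) by linarith
  moreover have "real (length s) \<ge> exp (-3) * (real n)\<^sup>2" if "\<forall>p\<in>P. subseq p s" for s
    using P(3)[OF that] L(2) by linarith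
  ultimately show "\<exists>P :: nat list set.
      P \<subseteq> permutations_of_set {1..n} \<and> real (card P) \<le> 2 powr g n \<and>
      (\<forall>s :: nat list. (\<forall>p\<in>P. subseq p s) \<longrightarrow> real (length s) \<ge> exp (-3) * (real n)\<^sup>2)"
    using P(1) by blast
qed

end
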